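(* Let $R$ be an elementary divisor domain (i.e., a domain that is an elementary divisor ring). Then the following are equivalent: (1) $R$ is a Bézout duo-domain. (2) $R$ satisfies Lam condition. (3) For any $a\in R$, if $RaR=R$ then there exist $s,t\in R$ such that $sat=1$.
   Context: All rings are associative with an identity, not necessarily commutative. A matrix $A$ (not necessarily square) over a ring $R$ admits diagonal reduction if there exist invertible matrices $P$ and $Q$ over $R$ such that $PAQ$ is a diagonal matrix $(d_{ij})$ with $Rd_{(i+1)(i+1)}R\subseteq d_{ii}R\cap Rd_{ii}$ for each $i$. A ring $R$ is an elementary divisor ring if every matrix over $R$ admits a diagonal reduction. A ring is a Bézout ring if every finitely generated right ideal and every finitely generated left ideal is principal. A ring is duo if every right ideal and every left ideal is a two-sided ideal. A domain is a ring with no nonzero zero divisors (not necessarily commutative). A Bézout duo-domain is a ring that is Bézout, duo and a domain. $RaR$ denotes the two-sided ideal generated by $a$. A ring $R$ satisfies Lam condition if, for every $a\in R$, $RaR=R$ implies that $a$ is invertible. *)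

theory Defs
  imports "Jordan_Normal_Form.Matrix"
begin

text \<open>
  A ring with identity, not necessarily commutative, is a type of class
  \<^class>\<open>ring_1\<close>; a domain is a type of class
  \<^class>\<open>ring_1_no_zero_divisors\<close>. In these classes 0 and 1 differ.
\<close>

definition right_ideal :: "'a::ring_1 set \<Rightarrow> bool" where
  "right_ideal I \<longleftrightarrow>
     0 \<in> I \<and> (\<forall>x\<in>I. \<forall>y\<in>I. x + y \<in> I) \<and> (\<forall>x\<in>I. \<forall>r. x * r \<in> I)"

definition left_ideal :: "'a::ring_1 set \<Rightarrow> bool" where
  "left_ideal I \<longleftrightarrow>
     0 \<in> I \<and> (\<forall>x\<in>I. \<forall>y\<in>I. x + y \<in> I) \<and> (\<forall>x\<in>I. \<forall>r. r * x \<in> I)"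

definition two_sided_ideal :: "'a::ring_1 set \<Rightarrow> bool" where
  "two_sided_ideal I \<longleftrightarrow> left_ideal I \<and> right_ideal I"

definition principal_right :: "'a::ring_1 \<Rightarrow> 'a set" where
  "principal_right a = {a * r | r. True}"

definition principal_left :: "'a::ring_1 \<Rightarrow> 'a set" where
  "principal_left a = {r * a | r. True}"

text \<open>The two-sided ideal RaR consists of the finite sums of products r a s,
  not just of the products themselves.\<close>

definition principal_two_sided :: "'a::ring_1 \<Rightarrow> 'a set" where
  "principal_two_sided a = two_sided_ideal hull {a}"

definition invertible_elem :: "'a::ring_1 \<Rightarrow> bool" where
  "invertible_elem a \<longleftrightarrow> (\<exists>b. a * b = 1 \<and> b * a = 1)"

text \<open>Matrix indices start at 0, and only the diagonal positions that exist in a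
  possibly non-square matrix are constrained.\<close>

definition admits_diagonal_reduction :: "'a::ring_1 mat \<Rightarrow> bool" where
  "admits_diagonal_reduction A \<longleftrightarrow>
     (\<exists>P Q. P \<in> carrier_mat (dim_row A) (dim_row A) \<and> invertible_mat P \<and>
            Q \<in> carrier_mat (dim_col A) (dim_col A) \<and> invertible_mat Q \<and>
            (let D = P * A * Q in
               diagonal_mat D \<and>
               (\<forall>i. i + 1 < min (dim_row A) (dim_col A) \<longrightarrow>
                  principal_two_sided (D $$ (i + 1, i + 1))
                    \<subseteq> principal_right (D $$ (i, i)) \<inter> principal_left (D $$ (i, i)))))"

definition elementary_divisor_ring :: "'a::ring_1 itself \<Rightarrow> bool" where
  "elementary_divisor_ring _ \<longleftrightarrow> (\<forall>A :: 'a mat. admits_diagonal_reduction A)"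

definition bezout_ring :: "'a::ring_1 itself \<Rightarrow> bool" where
  "bezout_ring _ \<longleftrightarrow>
     (\<forall>S :: 'a set. finite S \<longrightarrow> (\<exists>a. right_ideal hull S = principal_right a)) \<and>
     (\<forall>S :: 'a set. finite S \<longrightarrow> (\<exists>a. left_ideal hull S = principal_left a))"

definition duo_ring :: "'a::ring_1 itself \<Rightarrow> bool" where
  "duo_ring _ \<longleftrightarrow>
     (\<forall>I :: 'a set. right_ideal I \<longrightarrow> two_sided_ideal I) \<and>
     (\<forall>I :: 'a set. left_ideal I \<longrightarrow> two_sided_ideal I)"

text \<open>The domain part is the class constraint.\<close>

definition bezout_duo_domain :: "'a::ring_1_no_zero_divisors itself \<Rightarrow> bool" where
  "bezout_duo_domain R \<longleftrightarrow> bezout_ring R \<and> duo_ring R"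

definition lam_condition :: "'a::ring_1 itself \<Rightarrow> bool" where
  "lam_condition _ \<longleftrightarrow>
     (\<forall>a :: 'a. principal_two_sided a = UNIV \<longrightarrow> invertible_elem a)"

end

theory Submission
  imports Defs
begin

text \<open>
  The substantial implication is from the Lam condition to the Bezout duo property. Over a left
  Bezout ring, the Lam condition turns every right unimodular pair into a left unimodular one.
  Reduce \<open>diag(a, a)\<close> to \<open>diag(z, b)\<close> with \<open>RbR \<subseteq> zR \<inter> Rz\<close>. The second row \<open>(p, q)\<close> of the left
  transforming matrix is right unimodular and satisfies \<open>p a, q a \<in> bR\<close>; being also left
  unimodular, it yields \<open>a \<in> RbR\<close>. Since \<open>z \<in> RaR\<close>, it follows that \<open>RaR = zR = Rz\<close>. Writing
  \<open>a = z c\<close> gives \<open>zR = zRcR\<close>, so \<open>RcR = R\<close> and \<open>c\<close> is a unit; hence \<open>aR = RaR\<close>,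
  and symmetrically \<open>Ra = RaR\<close>.
\<close>

section \<open>Two-sided ideals and principal ideals\<close>

lemma two_sided_idealI:
  assumes "0 \<in> I" "\<And>x y. x \<in> I \<Longrightarrow> y \<in> I \<Longrightarrow> x + y \<in> I"
    and "\<And>x r. x \<in> I \<Longrightarrow> r * x \<in> I" "\<And>x r. x \<in> I \<Longrightarrow> x * r \<in> I"
  shows "two_sided_ideal I"
  using assms by (simp add: two_sided_ideal_def left_ideal_def right_ideal_def)

lemma two_sided_idealD:
  assumes "two_sided_ideal I"
  shows "0 \<in> I" "x \<in> I \<Longrightarrow> y \<in> I \<Longrightarrow> x + y \<in> I"
    and "x \<in> I \<Longrightarrow> r * x \<in> I" "x \<in> I \<Longrightarrow> x * r \<in> I"
  using assms by (simp_all add: two_sided_ideal_def left_ideal_def right_ideal_def)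

lemma two_sided_ideal_Inter:
  "(\<And>I. I \<in> F \<Longrightarrow> two_sided_ideal I) \<Longrightarrow> two_sided_ideal (\<Inter>F)"
  by (rule two_sided_idealI) (auto dest: two_sided_idealD)

lemma two_sided_ideal_principal: "two_sided_ideal (principal_two_sided a)"
  unfolding principal_two_sided_def by (rule hull_in) (blast intro: two_sided_ideal_Inter)

lemmas principal_two_sidedD = two_sided_idealD[OF two_sided_ideal_principal]

lemma mem_principal_two_sided: "a \<in> principal_two_sided a"
  by (simp add: principal_two_sided_def hull_inc)

lemma principal_two_sided_minimal:
  "two_sided_ideal I \<Longrightarrow> a \<in> I \<Longrightarrow> principal_two_sided a \<subseteq> I"
  by (simp add: principal_two_sided_def hull_minimal)

lemma principal_two_sided_eq_UNIV_iff:
  "principal_two_sided a = UNIV \<longleftrightarrow> 1 \<in> principal_two_sided a"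
  using principal_two_sidedD(3)[of 1 a] by fastforce

lemma left_ideal_principal: "left_ideal (principal_left a)"
  unfolding left_ideal_def principal_left_def
proof (safe, goal_cases)
  case 1 show ?case by (rule exI[of _ 0]) simp
next
  case (2 _ _ r s) show ?case by (rule exI[of _ "r + s"]) (simp add: distrib_right)
next
  case (3 _ r s) show ?case by (rule exI[of _ "s * r"]) (simp add: mult.assoc)
qed

lemma right_ideal_principal: "right_ideal (principal_right a)"
  unfolding right_ideal_def principal_right_def
proof (safe, goal_cases)
  case 1 show ?case by (rule exI[of _ 0]) simp
next
  case (2 _ _ r s) show ?case by (rule exI[of _ "r + s"]) (simp add: distrib_left)
next
  case (3 _ r s) show ?case by (rule exI[of _ "r * s"]) (simp add: mult.assoc)
qed

lemma mem_principal_left: "a \<in> principal_left a"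
  unfolding principal_left_def by (auto intro: exI[of _ 1])

lemma mem_principal_right: "a \<in> principal_right a"
  unfolding principal_right_def by (auto intro: exI[of _ 1])

lemma principal_one_sided_subset_two_sided:
  assumes "a \<in> principal_two_sided b"
  shows "principal_left a \<subseteq> principal_two_sided b" "principal_right a \<subseteq> principal_two_sided b"
  using assms by (auto simp: principal_left_def principal_right_def intro: principal_two_sidedD)

lemma left_ideal_hull_singleton: "left_ideal hull {a} = principal_left a"
  by (rule hull_unique)
    (auto simp: mem_principal_left left_ideal_principal, auto simp: principal_left_def left_ideal_def)

lemma right_ideal_hull_singleton: "right_ideal hull {a} = principal_right a"
  by (rule hull_unique)
    (auto simp: mem_principal_right right_ideal_principal, auto simp: principal_right_def right_ideal_def)

section \<open>One-sided inverses in a domain\<close>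

text \<open>From \<open>a * b = 1\<close> one gets \<open>b * a * b = b\<close>, and the nonzero
  factor \<open>b\<close> cancels on the right.\<close>

lemma mult_eq_1_commute:
  fixes a b :: "'a::ring_1_no_zero_divisors"
  assumes "a * b = 1"
  shows "b * a = 1"
proof -
  have "(b * a) * b = 1 * b"
    using assms by (simp add: mult.assoc)
  moreover have "b \<noteq> 0"
    using assms by auto
  ultimately show ?thesis
    using mult_right_cancel by blast
qed

text \<open>Commuting the factors \<open>s\<close> and \<open>a * t\<close> shows that
  \<open>t * s\<close> is a right inverse of \<open>a\<close>, and in a domain such an inverse is
  two-sided.\<close>

lemma invertible_elem_if_mult_eq_1:
  fixes a :: "'a::ring_1_no_zero_divisors"
  assumes "s * a * t = 1"
  shows "invertible_elem a"
proof -
  have "a * (t * s) = 1"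
    using mult_eq_1_commute[of s "a * t"] assms by (simp add: mult.assoc)
  then show ?thesis
    using mult_eq_1_commute unfolding invertible_elem_def by blast
qed

section \<open>Diagonal reductions and the left Bezout property\<close>

lemma invertible_mat_obtain_inverse:
  assumes "invertible_mat P" "P \<in> carrier_mat n n"
  obtains P' where "P' \<in> carrier_mat n n" "P * P' = 1\<^sub>m n" "P' * P = 1\<^sub>m n"
proof -
  obtain B where B: "P * B = 1\<^sub>m n" "B * P = 1\<^sub>m (dim_row B)"
    using assms unfolding invertible_mat_def inverts_mat_def by auto
  \<comment> \<open>The definition of \<open>invertible_mat\<close> does not fix the shape of
    \<open>B\<close>; comparing column counts in the two product equations does.\<close>
  have "dim_col B = n" "dim_row B = n"
    using arg_cong[OF B(1), of dim_col] arg_cong[OF B(2), of dim_col] assms(2) by auto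
  with B show thesis
    by (intro that[of B]) auto
qed

lemma mult_mat_entry_1:
  assumes "A \<in> carrier_mat n 1" "B \<in> carrier_mat 1 m" "i < n" "j < m"
  shows "(A * B) $$ (i, j) = A $$ (i, 0) * B $$ (0, j)"
  using assms by (simp add: scalar_prod_def)

lemma mult_mat_entry_2:
  assumes "A \<in> carrier_mat n 2" "B \<in> carrier_mat 2 m" "i < n" "j < m"
  shows "(A * B) $$ (i, j) = A $$ (i, 0) * B $$ (0, j) + A $$ (i, 1) * B $$ (1, j)"
  using assms by (simp add: scalar_prod_def numeral_2_eq_2)

text \<open>Explicit inverses turn \<open>D = P * A * Q\<close> into the one-sided forms
  \<open>P * A = D * Q'\<close> and \<open>A * Q = P' * D\<close>, from which relations between
  entries of \<open>A\<close> and \<open>D\<close> can be read off.\<close>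

lemma admits_diagonal_reduction_obtain:
  fixes A :: "'a::ring_1 mat"
  assumes "admits_diagonal_reduction A" "A \<in> carrier_mat m n"
  obtains P P' Q Q' D where
    "P \<in> carrier_mat m m" "P' \<in> carrier_mat m m" "Q \<in> carrier_mat n n" "Q' \<in> carrier_mat n n"
    "P * P' = 1\<^sub>m m" "P' * P = 1\<^sub>m m" "Q * Q' = 1\<^sub>m n" "Q' * Q = 1\<^sub>m n"
    "D \<in> carrier_mat m n" "D = P * A * Q" "P * A = D * Q'" "A * Q = P' * D"
    "\<And>i j. i < m \<Longrightarrow> j < n \<Longrightarrow> i \<noteq> j \<Longrightarrow> D $$ (i, j) = 0"
    "\<And>i. i + 1 < min m n \<Longrightarrow> principal_two_sided (D $$ (i + 1, i + 1))
        \<subseteq> principal_right (D $$ (i, i)) \<inter> principal_left (D $$ (i, i))"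
proof -
  obtain P Q where P: "P \<in> carrier_mat m m" "invertible_mat P"
    and Q: "Q \<in> carrier_mat n n" "invertible_mat Q"
    and diag: "diagonal_mat (P * A * Q)"
    and dvd: "\<And>i. i + 1 < min m n \<Longrightarrow> principal_two_sided ((P * A * Q) $$ (i + 1, i + 1))
        \<subseteq> principal_right ((P * A * Q) $$ (i, i)) \<inter> principal_left ((P * A * Q) $$ (i, i))"
    using assms unfolding admits_diagonal_reduction_def Let_def by auto
  obtain P' where P': "P' \<in> carrier_mat m m" "P * P' = 1\<^sub>m m" "P' * P = 1\<^sub>m m"
    using invertible_mat_obtain_inverse P by blast
  obtain Q' where Q': "Q' \<in> carrier_mat n n" "Q * Q' = 1\<^sub>m n" "Q' * Q = 1\<^sub>m n"
    using invertible_mat_obtain_inverse Q by blast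
  have PA: "P * A \<in> carrier_mat m n" and AQ: "A * Q \<in> carrier_mat m n"
    using P Q assms(2) by auto
  have "P * A * Q * Q' = P * A * (Q * Q')"
    using PA Q(1) Q'(1) by (rule assoc_mult_mat)
  also have "\<dots> = P * A"
    using right_mult_one_mat[OF PA] Q'(2) by simp
  finally have 1: "P * A = P * A * Q * Q'" ..
  have "P' * (P * A * Q) = P' * (P * (A * Q))"
    using assoc_mult_mat[OF P(1) assms(2) Q(1)] by simp
  also have "\<dots> = P' * P * (A * Q)"
    using assoc_mult_mat[OF P'(1) P(1) AQ] by simp
  also have "\<dots> = A * Q"
    using left_mult_one_mat[OF AQ] P'(3) by simp
  finally have 2: "A * Q = P' * (P * A * Q)" ..
  show thesis
    by (rule that[OF P(1) P'(1) Q(1) Q'(1) P'(2,3) Q'(2,3) _ refl 1 2])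
      (use P Q assms(2) diag dvd in \<open>auto simp: diagonal_mat_def\<close>)
qed

text \<open>The generator is the entry of the reduced column \<open>(x, y)\<close>, corrected by the unit coming
  from the \<open>1 \<times> 1\<close> right factor.\<close>

lemma left_bezout_pair:
  fixes x y :: "'a::ring_1"
  assumes "elementary_divisor_ring TYPE('a)"
  obtains d u v where "d = u * x + v * y" "x \<in> principal_left d" "y \<in> principal_left d"
proof -
  \<comment> \<open>A column is chosen because \<open>P\<close> acts from the left, so that row
    operations form left combinations of \<open>x\<close> and \<open>y\<close>.\<close>
  define A where "A = mat 2 1 (\<lambda>(i, j). if i = 0 then x else y)"
  have A: "A \<in> carrier_mat 2 1" "A $$ (0, 0) = x" "A $$ (1, 0) = y"
    by (simp_all add: A_def)
  have "admits_diagonal_reduction A"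
    using assms by (simp add: elementary_divisor_ring_def)
  then obtain P P' Q Q' D where
    c: "P \<in> carrier_mat 2 2" "P' \<in> carrier_mat 2 2" "Q \<in> carrier_mat 1 1" "Q' \<in> carrier_mat 1 1"
      "D \<in> carrier_mat 2 1"
    and QQ': "Q * Q' = 1\<^sub>m 1" and PA: "P * A = D * Q'" and AQ: "A * Q = P' * D"
    and D: "\<And>i j. i < 2 \<Longrightarrow> j < 1 \<Longrightarrow> i \<noteq> j \<Longrightarrow> D $$ (i, j) = 0"
    using A(1) by (rule admits_diagonal_reduction_obtain) blast
  let ?d = "D $$ (0, 0) * Q' $$ (0, 0)"
  have D1: "D $$ (Suc 0, 0) = 0"
    using D[of 1 0] by simp
  have q: "Q $$ (0, 0) * Q' $$ (0, 0) = 1"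
    using mult_mat_entry_1[OF c(3,4), of 0 0] QQ' by simp
  have d: "?d = P $$ (0, 0) * x + P $$ (0, 1) * y"
    using mult_mat_entry_2[OF c(1) A(1), of 0 0] mult_mat_entry_1[OF c(5,4), of 0 0] PA A by simp
  have "A $$ (i, 0) \<in> principal_left ?d" if "i < 2" for i
  proof -
    have "A $$ (i, 0) * Q $$ (0, 0) = P' $$ (i, 0) * D $$ (0, 0)"
      using mult_mat_entry_2[OF c(2,5) that, of 0] mult_mat_entry_1[OF A(1) c(3) that, of 0] AQ D1
      by simp
    \<comment> \<open>Multiplying by the entry of \<open>Q'\<close> cancels the entry of
      \<open>Q\<close> on the left side and completes \<open>?d\<close> on the right side.\<close>
    then have "A $$ (i, 0) * (Q $$ (0, 0) * Q' $$ (0, 0)) = P' $$ (i, 0) * ?d"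
      by (simp flip: mult.assoc)
    then show ?thesis
      using q by (auto simp: principal_left_def)
  qed
  from this[of 0] this[of 1] show thesis
    using A d by (intro that[of ?d]) auto
qed

text \<open>By induction on the generators: the pair lemma merges a new element with the generator
  already found.\<close>

lemma left_bezout:
  fixes S :: "'a::ring_1 set"
  assumes "elementary_divisor_ring TYPE('a)" "finite S"
  shows "\<exists>a. left_ideal hull S = principal_left a"
  using assms(2)
proof induction
  case empty
  have "left_ideal hull {} = principal_left (0::'a)"
    by (rule hull_unique) (auto simp: left_ideal_principal, auto simp: principal_left_def left_ideal_def)
  then show ?case ..
next
  case (insert x S)
  then obtain a where a: "left_ideal hull S = principal_left a"
    by blast
  obtain d u v where d: "d = u * x + v * a" "x \<in> principal_left d" "a \<in> principal_left d"
    using left_bezout_pair[OF assms(1)] .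
  have "left_ideal hull insert x S = principal_left d"
  proof (rule hull_unique)
    have "principal_left a \<subseteq> principal_left d"
      using hull_minimal[of "{a}" "principal_left d" left_ideal] d(3)
      by (simp add: left_ideal_principal left_ideal_hull_singleton)
    then show "insert x S \<subseteq> principal_left d"
      using a d(2) hull_subset[of S left_ideal] by auto
  next
    fix T assume T: "insert x S \<subseteq> T" "left_ideal T"
    then have "a \<in> T" "x \<in> T"
      using hull_minimal[of S T left_ideal] a mem_principal_left by blast+
    then have "d \<in> T"
      using T(2) d(1) by (simp add: left_ideal_def)
    then show "principal_left d \<subseteq> T"
      using T(2) by (auto simp: principal_left_def left_ideal_def)
  qed (rule left_ideal_principal)
  then show ?case ..
qed

section \<open>Principal two-sided ideals under the Lam condition\<close>

text \<open>A generator \<open>d\<close> of the left ideal \<open>Rp + Rq\<close> satisfies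
  \<open>RdR = R\<close>, since \<open>RdR\<close> contains \<open>p\<close> and \<open>q\<close>
  and hence 1. The Lam condition makes \<open>d\<close> a unit, and its inverse rescales
  \<open>d = u * p + v * q\<close> to 1.\<close>

lemma left_unimodular_if_right_unimodular:
  fixes p q :: "'a::ring_1"
  assumes edr: "elementary_divisor_ring TYPE('a)" and lam: "lam_condition TYPE('a)"
    and "p * r + q * s = 1"
  obtains u v where "u * p + v * q = 1"
proof -
  obtain d u v where d: "d = u * p + v * q" "p \<in> principal_left d" "q \<in> principal_left d"
    using left_bezout_pair[OF edr] .
  then have "p \<in> principal_two_sided d" "q \<in> principal_two_sided d"
    using principal_one_sided_subset_two_sided(1)[OF mem_principal_two_sided] by blast+
  then have "1 \<in> principal_two_sided d"
    unfolding assms(3)[symmetric] by (blast intro: principal_two_sidedD)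
  then obtain e where "e * d = 1"
    using lam unfolding lam_condition_def invertible_elem_def
    by (metis principal_two_sided_eq_UNIV_iff)
  then have "(e * u) * p + (e * v) * q = 1"
    using d(1) by (simp add: distrib_left mult.assoc)
  then show thesis
    by (rule that)
qed

lemma reduction_of_scalar_matrix:
  fixes a :: "'a::ring_1"
  assumes edr: "elementary_divisor_ring TYPE('a)" and lam: "lam_condition TYPE('a)"
  obtains z where "principal_two_sided a = principal_right z"
    "principal_two_sided a = principal_left z"
proof -
  define A where "A = mat 2 2 (\<lambda>(i, j). if i = j then a else 0)"
  have A: "A \<in> carrier_mat 2 2" "A $$ (0, 0) = a" "A $$ (1, 1) = a"
    "A $$ (0, 1) = 0" "A $$ (1, 0) = 0"
    by (simp_all add: A_def)
  have "admits_diagonal_reduction A"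
    using edr by (simp add: elementary_divisor_ring_def)
  then obtain P P' Q Q' D where
    c: "P \<in> carrier_mat 2 2" "P' \<in> carrier_mat 2 2" "Q \<in> carrier_mat 2 2" "Q' \<in> carrier_mat 2 2"
      "D \<in> carrier_mat 2 2"
    and PP': "P * P' = 1\<^sub>m 2" and PAQ: "D = P * A * Q" and PA: "P * A = D * Q'"
    and D: "\<And>i j. i < 2 \<Longrightarrow> j < 2 \<Longrightarrow> i \<noteq> j \<Longrightarrow> D $$ (i, j) = 0"
    and dvd: "\<And>i. i + 1 < min 2 2 \<Longrightarrow> principal_two_sided (D $$ (i + 1, i + 1))
        \<subseteq> principal_right (D $$ (i, i)) \<inter> principal_left (D $$ (i, i))"
    using A(1) by (rule admits_diagonal_reduction_obtain) blast
  define z b where "z = D $$ (0, 0)" and "b = D $$ (1, 1)"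
  have b: "principal_two_sided b \<subseteq> principal_right z \<inter> principal_left z"
    using dvd[of 0] by (simp add: z_def b_def)
  \<comment> \<open>As \<open>A\<close> is scalar, multiplying by it puts \<open>a\<close> to the
    right of every entry of \<open>P\<close>.\<close>
  have PAe: "(P * A) $$ (i, j) = P $$ (i, j) * a" if "i < 2" "j < 2" for i j
    using mult_mat_entry_2[OF c(1) A(1) that] that A less_2_cases[OF that(2)] by auto
  have "z = P $$ (0, 0) * a * Q $$ (0, 0) + P $$ (0, 1) * a * Q $$ (1, 0)"
    using mult_mat_entry_2[OF mult_carrier_mat[OF c(1) A(1)] c(3), of 0 0] PAQ
    by (simp add: z_def PAe)
  then have z: "z \<in> principal_two_sided a"
    by (simp only:) (blast intro: principal_two_sidedD mem_principal_two_sided)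
  \<comment> \<open>In the second row of \<open>D * Q'\<close> only the diagonal entry
    \<open>b\<close> of \<open>D\<close> survives.\<close>
  have row: "P $$ (1, j) * a = b * Q' $$ (1, j)" if "j < 2" for j
    using mult_mat_entry_2[OF c(5,4), of 1 j] that PA PAe[of 1 j] D[of 1 0] by (simp add: b_def)
  have "P $$ (1, 0) * P' $$ (0, 1) + P $$ (1, 1) * P' $$ (1, 1) = 1"
    using mult_mat_entry_2[OF c(1,2), of 1 1] PP' by simp
  from left_unimodular_if_right_unimodular[OF edr lam this] obtain u v
    where uv: "u * P $$ (1, 0) + v * P $$ (1, 1) = 1" .
  \<comment> \<open>Left coefficients are essential here: they leave the products
    \<open>P $$ (1, j) * a\<close> intact, whereas right unimodularity would insert coefficients
    before \<open>a\<close>.\<close>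
  have "a = u * (P $$ (1, 0) * a) + v * (P $$ (1, 1) * a)"
    using uv by (metis mult.assoc distrib_right mult_1_left)
  also have "\<dots> = u * (b * Q' $$ (1, 0)) + v * (b * Q' $$ (1, 1))"
    using row[of 0] row[of 1] by simp
  also have "\<dots> \<in> principal_two_sided b"
    by (blast intro: principal_two_sidedD mem_principal_two_sided)
  finally have "principal_two_sided a \<subseteq> principal_two_sided b"
    by (rule principal_two_sided_minimal[OF two_sided_ideal_principal])
  \<comment> \<open>The inclusions close into the cycle \<open>RaR\<close>, \<open>RbR\<close>,
    \<open>zR\<close> (or \<open>Rz\<close>), \<open>RaR\<close>.\<close>
  then show thesis
    using b principal_one_sided_subset_two_sided[OF z] by (intro that[of z]) blast+
qed

lemma principal_two_sided_eq_principal: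
  fixes a :: "'a::ring_1_no_zero_divisors"
  assumes edr: "elementary_divisor_ring TYPE('a)" and lam: "lam_condition TYPE('a)"
  shows "principal_two_sided a = principal_right a" "principal_two_sided a = principal_left a"
proof -
  obtain z where zr: "principal_two_sided a = principal_right z"
    and zl: "principal_two_sided a = principal_left z"
    using reduction_of_scalar_matrix[OF edr lam] .
  have za: "z \<in> principal_two_sided a"
    by (simp add: zr mem_principal_right)
  have "principal_two_sided a = principal_right a \<and> principal_two_sided a = principal_left a"
  proof (cases "z = 0")
    case True
    then have "a = 0"
      using mem_principal_two_sided[of a] by (auto simp: zr principal_right_def)
    then show ?thesis
      using True zr zl by simp
  next
    case False
    obtain c where c: "a = z * c"
      using mem_principal_two_sided[of a] by (auto simp: zr principal_right_def)
    obtain e where e: "a = e * z"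
      using mem_principal_two_sided[of a] by (auto simp: zl principal_left_def)
    \<comment> \<open>\<open>Rz = zR\<close> lets any factor pass from one side of \<open>z\<close>
      to the other, at the price of changing it. This is what makes the images \<open>?I\<close> and
      \<open>?J\<close> below two-sided.\<close>
    have comm: "\<exists>r'. r * z = z * r'" "\<exists>r'. z * r = r' * z" for r
      using zr zl by (auto simp: principal_left_def principal_right_def)
    have "two_sided_ideal ((*) z ` principal_two_sided c)" (is "two_sided_ideal ?I")
    proof (rule two_sided_idealI)
      show "0 \<in> ?I"
        by (rule image_eqI[of _ _ 0]) (simp_all add: principal_two_sidedD)
    next
      fix x r assume "x \<in> ?I"
      then obtain j where j: "j \<in> principal_two_sided c" "x = z * j"
        by blast
      obtain r' where "r * z = z * r'"
        using comm by blast
      then have "r * x = z * (r' * j)"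
        using j(2) by (metis mult.assoc)
      then show "r * x \<in> ?I"
        using j(1) by (auto intro: principal_two_sidedD)
      show "x * r \<in> ?I"
        using j by (auto simp: mult.assoc intro: principal_two_sidedD)
      show "x + y \<in> ?I" if "y \<in> ?I" for y
        using that j by (auto simp flip: distrib_left intro: principal_two_sidedD)
    qed
    \<comment> \<open>The ideal \<open>z * RcR\<close> contains \<open>a = z * c\<close>, hence all
      of \<open>RaR\<close> and in particular \<open>z\<close>. Cancelling the nonzero
      \<open>z\<close> then puts 1 into \<open>RcR\<close>.\<close>
    then have "z \<in> ?I"
      using principal_two_sided_minimal[of ?I a] za c mem_principal_two_sided by blast
    then have "principal_two_sided c = UNIV"
      using False by (auto simp: principal_two_sided_eq_UNIV_iff)
    then obtain c' where c': "c * c' = 1"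
      using lam by (auto simp: lam_condition_def invertible_elem_def)
    \<comment> \<open>The mirror argument for \<open>a = e * z\<close>, with \<open>z\<close> now
      cancelled on the right.\<close>
    have "two_sided_ideal ((\<lambda>j. j * z) ` principal_two_sided e)" (is "two_sided_ideal ?J")
    proof (rule two_sided_idealI)
      show "0 \<in> ?J"
        by (rule image_eqI[of _ _ 0]) (simp_all add: principal_two_sidedD)
    next
      fix x r assume "x \<in> ?J"
      then obtain j where j: "j \<in> principal_two_sided e" "x = j * z"
        by blast
      obtain r' where "z * r = r' * z"
        using comm by blast
      then have "x * r = (j * r') * z"
        using j(2) by (metis mult.assoc)
      then show "x * r \<in> ?J"
        using j(1) by (auto intro: principal_two_sidedD)
      show "r * x \<in> ?J"
        using j by (auto simp flip: mult.assoc intro: principal_two_sidedD)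
      show "x + y \<in> ?J" if "y \<in> ?J" for y
        using that j by (auto simp flip: distrib_right intro: principal_two_sidedD)
    qed
    then have "z \<in> ?J"
      using principal_two_sided_minimal[of ?J a] za e mem_principal_two_sided by blast
    then have "principal_two_sided e = UNIV"
      using False by (auto simp: principal_two_sided_eq_UNIV_iff)
    then obtain e' where e': "e' * e = 1"
      using lam by (auto simp: lam_condition_def invertible_elem_def)
    \<comment> \<open>The inverses solve \<open>a = z * c\<close> and \<open>a = e * z\<close> for
      \<open>z\<close>, so that \<open>z\<close> lies in both \<open>aR\<close> and
      \<open>Ra\<close>.\<close>
    have "z = a * c'"
      using c c' by (simp add: mult.assoc)
    then have "z * r = a * (c' * r)" for r
      by (simp add: mult.assoc)
    then have "principal_right z \<subseteq> principal_right a"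
      unfolding principal_right_def by blast
    moreover have "z = e' * a"
      using e e' by (simp flip: mult.assoc)
    then have "r * z = (r * e') * a" for r
      by (simp add: mult.assoc)
    then have "principal_left z \<subseteq> principal_left a"
      unfolding principal_left_def by blast
    ultimately show ?thesis
      using zr zl principal_one_sided_subset_two_sided[OF mem_principal_two_sided] by blast
  qed
  then show "principal_two_sided a = principal_right a" "principal_two_sided a = principal_left a"
    by auto
qed

section \<open>Duo and Bezout properties, and the equivalences\<close>

text \<open>Both \<open>Rx\<close> and \<open>xR\<close> equal \<open>RxR\<close>, so a left
  multiple of \<open>x\<close> is also a right multiple and stays in every right ideal containing
  \<open>x\<close>; likewise with the sides exchanged.\<close>

lemma duo_ring_if_lam_condition:
  assumes "elementary_divisor_ring TYPE('a::ring_1_no_zero_divisors)" "lam_condition TYPE('a)"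
  shows "duo_ring TYPE('a)"
proof -
  have eq: "principal_left x = principal_right x" for x :: 'a
    using principal_two_sided_eq_principal[OF assms, of x] by simp
  have "r * x \<in> I" if "right_ideal I" "x \<in> I" for r x and I :: "'a set"
  proof -
    have "r * x \<in> principal_right x"
      unfolding eq[symmetric] by (auto simp: principal_left_def)
    then show ?thesis
      using that by (auto simp: principal_right_def right_ideal_def)
  qed
  moreover have "x * r \<in> I" if "left_ideal I" "x \<in> I" for r x and I :: "'a set"
  proof -
    have "x * r \<in> principal_left x"
      unfolding eq by (auto simp: principal_right_def)
    then show ?thesis
      using that by (auto simp: principal_left_def left_ideal_def)
  qed
  ultimately show ?thesis
    unfolding duo_ring_def two_sided_ideal_def by (metis left_ideal_def right_ideal_def)
qed

text \<open>In a duo ring left and right ideals are the same sets, so the left Bezout property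
  carries over to the right.\<close>

lemma bezout_ring_if_duo_ring:
  assumes "elementary_divisor_ring TYPE('a::ring_1)" "duo_ring TYPE('a)"
  shows "bezout_ring TYPE('a)"
proof -
  have "right_ideal = (left_ideal :: 'a set \<Rightarrow> bool)"
    using assms(2) by (auto simp: duo_ring_def two_sided_ideal_def)
  then show ?thesis
    using left_bezout[OF assms(1)]
    \<comment> \<open>Writing principal ideals as hulls of singletons lets the equality of the two
      ideal predicates transfer them as well.\<close>
    by (simp add: bezout_ring_def flip: left_ideal_hull_singleton right_ideal_hull_singleton)
qed

text \<open>The right ideal \<open>aR\<close> is two-sided and contains \<open>a\<close>, so it
  contains \<open>RaR = R\<close>; this gives a right inverse of \<open>a\<close>.\<close>

lemma lam_condition_if_duo_ring:
  assumes "duo_ring TYPE('a::ring_1_no_zero_divisors)"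
  shows "lam_condition TYPE('a)"
  unfolding lam_condition_def
proof (intro allI impI)
  fix a :: 'a assume "principal_two_sided a = UNIV"
  moreover have "two_sided_ideal (principal_right a)"
    using assms right_ideal_principal by (auto simp: duo_ring_def)
  ultimately have "1 \<in> principal_right a"
    using principal_two_sided_minimal mem_principal_right by blast
  then obtain b where "1 * a * b = 1"
    by (auto simp: principal_right_def)
  then show "invertible_elem a"
    by (rule invertible_elem_if_mult_eq_1)
qed

theorem theorem2p5:
  fixes R :: "'a::ring_1_no_zero_divisors itself"
  assumes "elementary_divisor_ring R"
  shows "(bezout_duo_domain R \<longleftrightarrow> lam_condition R) \<and>
         (lam_condition R \<longleftrightarrow>
            (\<forall>a :: 'a. principal_two_sided a = UNIV \<longrightarrow> (\<exists>s t. s * a * t = 1)))"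
proof
  \<comment> \<open>\<open>R\<close> only carries the type, so the facts about
    \<open>TYPE('a)\<close> apply to it after unfolding.\<close>
  have edr: "elementary_divisor_ring TYPE('a)"
    using assms by (simp add: elementary_divisor_ring_def)
  have "bezout_duo_domain TYPE('a) \<longleftrightarrow> lam_condition TYPE('a)"
    unfolding bezout_duo_domain_def
    using bezout_ring_if_duo_ring[OF edr] duo_ring_if_lam_condition[OF edr]
      lam_condition_if_duo_ring by blast
  then show "bezout_duo_domain R \<longleftrightarrow> lam_condition R"
    by (simp add: bezout_duo_domain_def bezout_ring_def duo_ring_def lam_condition_def)
  \<comment> \<open>In a domain the conclusions of (2) and (3) agree for each single element; the
    forward direction takes \<open>s = 1\<close>.\<close>
  have "invertible_elem a \<longleftrightarrow> (\<exists>s t. s * a * t = 1)" for a :: 'a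
    using invertible_elem_if_mult_eq_1 by (metis invertible_elem_def mult_1_left)
  then show "lam_condition R \<longleftrightarrow>
      (\<forall>a :: 'a. principal_two_sided a = UNIV \<longrightarrow> (\<exists>s t. s * a * t = 1))"
    by (simp add: lam_condition_def)
qed

end
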